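(* Let $A=(a,b,c,d,u_0,w_0)$ be real parameters with $ad-bc=1$ and $b\neq 0$. Let $\phi,\psi\in L^2(\mathbb{R})\setminus\{0\}$ be window functions and $f,g\in L^2(\mathbb{R})$. Then $$\int_{\mathbb{R}}\int_{\mathbb{R}}V^{A}_{\phi}f(u,w)\,\overline{V^{A}_{\psi}g(u,w)}\,du\,dw=\langle f,g\rangle\,\langle\psi,\phi\rangle .$$
   Context: All functions are complex-valued, and $\langle f,g\rangle=\int_{\mathbb{R}}f(t)\overline{g(t)}\,dt$ is the inner product of $L^2(\mathbb{R})$. For $A=(a,b,c,d,u_0,w_0)\in\mathbb{R}^6$ with $ad-bc=1$, $b\neq 0$, the offset linear canonical transform kernel is $$K_A(t,u)=\frac{1}{\sqrt{i2\pi b}}\exp\Big(i\frac{a}{2b}t^2-i\frac1b t(u-u_0)-i\frac1b u(du_0-bw_0)+i\frac{d}{2b}(u^2+u_0^2)\Big)$$ (principal square root). For $\phi\in L^2(\mathbb{R})\setminus\{0\}$ and $f\in L^2(\mathbb{R})$, the windowed offset linear canonical transform (WOLCT) is $$V^A_\phi f(u,w)=\int_{\mathbb{R}} f(t)\,\overline{\phi(t-w)}\,K_A(t,u)\,dt .$$ *)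

theory Defs
  imports "HOL-Analysis.Analysis"
begin

text \<open>
  Elements of \<open>L\<^sup>2(\<real>)\<close> are given by representatives: Lebesgue measurable, square integrable
  functions. Such a function is nonzero as an element of \<open>L\<^sup>2(\<real>)\<close> iff it is not zero almost
  everywhere.
\<close>

definition L2 :: "(real \<Rightarrow> complex) set" where
  "L2 = {f \<in> borel_measurable lebesgue. integrable lebesgue (\<lambda>t. (cmod (f t))\<^sup>2)}"

definition L2_nonzero :: "(real \<Rightarrow> complex) set" where
  "L2_nonzero = {f \<in> L2. \<not> (AE t in lebesgue. f t = 0)}"

definition L2_inner :: "(real \<Rightarrow> complex) \<Rightarrow> (real \<Rightarrow> complex) \<Rightarrow> complex" where
  "L2_inner f g = (LINT t|lebesgue. f t * cnj (g t))"

text \<open>The parameters are \<open>A = (a, b, c, d, u\<^sub>0, w\<^sub>0)\<close>.\<close>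

type_synonym olct_param = "real \<times> real \<times> real \<times> real \<times> real \<times> real"

fun olct_kernel :: "olct_param \<Rightarrow> real \<Rightarrow> real \<Rightarrow> complex" where
  "olct_kernel (a, b, c, d, u0, w0) t u =
     1 / csqrt (\<i> * 2 * of_real pi * of_real b) *
     exp (\<i> * of_real (a / (2 * b) * t\<^sup>2)
          - \<i> * of_real (1 / b * t * (u - u0))
          - \<i> * of_real (1 / b * u * (d * u0 - b * w0))
          + \<i> * of_real (d / (2 * b) * (u\<^sup>2 + u0\<^sup>2)))"

definition wolct ::
  "olct_param \<Rightarrow> (real \<Rightarrow> complex) \<Rightarrow> (real \<Rightarrow> complex) \<Rightarrow> real \<Rightarrow> real \<Rightarrow> complex" where
  "wolct A \<phi> f u w = (LINT t|lebesgue. f t * cnj (\<phi> (t - w)) * olct_kernel A t u)"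

end

theory Submission
  imports Defs "HOL-Probability.Characteristic_Functions"
begin

text \<open>
  For fixed \<open>w\<close> the transform is, up to a factor of constant modulus \<open>1 / sqrt (2 \<pi> \<bar>b\<bar>)\<close>, the Fourier
  transform at \<open>(u - u\<^sub>0) / b\<close> of \<open>t \<mapsto> f t * cnj (\<phi> (t - w)) * exp (i a t\<^sup>2 / (2 b))\<close>, which is in
  L1 for every \<open>w\<close> and in L2 for almost every \<open>w\<close>. Plancherel evaluates the integral over \<open>u\<close> as
  \<open>\<integral> f t * cnj (g t) * \<psi> (t - w) * cnj (\<phi> (t - w)) dt\<close>; the chirps cancel, and integration over
  \<open>w\<close> splits this into the two inner products. Plancherel on the intersection of L1 and L2 is
  obtained by inserting a Gaussian of growing width, which tests the correlation function of the
  two inputs against an approximate identity, and the correlation function is continuous at 0.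
\<close>

subsection \<open>Square integrable functions\<close>

text \<open>Borel counterpart of \<open>L2\<close>. Affine substitutions and Fubini on
  \<open>lborel\<close> ask for Borel measurability; \<open>L2_borel_representative\<close> moves
  each class into this setting.\<close>

definition sq_integrable :: "(real \<Rightarrow> complex) \<Rightarrow> bool" where
  "sq_integrable f \<longleftrightarrow> f \<in> borel_measurable borel \<and> integrable lborel (\<lambda>t. (cmod (f t))\<^sup>2)"

lemma sq_integrable_measurable [measurable_dest]:
  "sq_integrable f \<Longrightarrow> f \<in> borel_measurable borel"
  by (simp add: sq_integrable_def)

lemma sq_integrable_norm:
  "sq_integrable f \<Longrightarrow> integrable lborel (\<lambda>t. (cmod (f t))\<^sup>2)"
  by (simp add: sq_integrable_def)

lemma borel_measurable_cnj [measurable (raw)]: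
  "f \<in> borel_measurable M \<Longrightarrow> (\<lambda>x. cnj (f x)) \<in> borel_measurable M"
  by (rule measurable_compose[OF _ borel_measurable_continuous_onI[OF continuous_on_cnj[OF continuous_on_id]]])

lemma sq_integrable_cnj: "sq_integrable f \<Longrightarrow> sq_integrable (\<lambda>t. cnj (f t))"
  by (auto simp: sq_integrable_def)

lemma sq_integrable_shift:
  assumes "sq_integrable f"
  shows "sq_integrable (\<lambda>t. f (t + r))"
  using assms lborel_integrable_real_affine[of "\<lambda>t. (cmod (f t))\<^sup>2" 1 r]
  unfolding sq_integrable_def by (auto simp: add.commute)

lemma integral_shift:
  fixes f :: "real \<Rightarrow> 'a :: {banach, second_countable_topology}"
  shows "(LINT t|lborel. f (t + r)) = (LINT t|lborel. f t)"
  using lborel_integral_real_affine[of 1 f r] by (simp add: add.commute)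

text \<open>Expanding a square suffices. The free weight \<open>l\<close> trades the size of one
  factor against the other, which does the work of Cauchy-Schwarz below.\<close>

lemma norm_mult_le_weighted:
  assumes "l > 0"
  shows "cmod (x * y) \<le> (cmod x)\<^sup>2 / (2 * l) + l * (cmod y)\<^sup>2 / 2"
proof -
  have "0 \<le> (cmod x - l * cmod y)\<^sup>2" by simp
  then show ?thesis using assms
    by (simp add: norm_mult field_simps power2_eq_square)
qed

lemma sq_integrable_mult:
  assumes "sq_integrable f" "sq_integrable g"
  shows "integrable lborel (\<lambda>t. f t * g t)"
proof (rule Bochner_Integration.integrable_bound)
  show "integrable lborel (\<lambda>t. (cmod (f t))\<^sup>2 / (2 * 1) + 1 * (cmod (g t))\<^sup>2 / 2)"
    using assms by (auto simp: sq_integrable_def)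
  show "AE t in lborel. cmod (f t * g t) \<le> norm ((cmod (f t))\<^sup>2 / (2 * 1) + 1 * (cmod (g t))\<^sup>2 / 2)"
    unfolding real_norm_def
    by (intro always_eventually allI order_trans[OF norm_mult_le_weighted abs_ge_self]) simp
qed (use assms in measurable)

lemma norm_integral_mult_le:
  assumes "sq_integrable f" "sq_integrable g" "l > 0"
  shows "cmod (LINT t|lborel. f t * g t)
    \<le> (LINT t|lborel. (cmod (f t))\<^sup>2) / (2 * l) + l * (LINT t|lborel. (cmod (g t))\<^sup>2) / 2"
proof -
  have "cmod (LINT t|lborel. f t * g t) \<le> (LINT t|lborel. (cmod (f t))\<^sup>2 / (2 * l) + l * (cmod (g t))\<^sup>2 / 2)"
    using sq_integrable_mult[OF assms(1,2)] assms
    by (intro order_trans[OF integral_norm_bound integral_mono] integrable_norm norm_mult_le_weighted)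
      (auto simp: sq_integrable_def)
  also have "\<dots> = (LINT t|lborel. (cmod (f t))\<^sup>2) / (2 * l) + l * (LINT t|lborel. (cmod (g t))\<^sup>2) / 2"
    using assms by (simp add: sq_integrable_def)
  finally show ?thesis .
qed

subsection \<open>Approximation by continuous functions and continuity of correlations\<close>

text \<open>The discarded part is either 0 or \<open>h x\<close>, so \<open>h\<close> itself
  dominates it, and at each point it vanishes once \<open>n\<close> reaches both the modulus of
  \<open>x\<close> and that of \<open>h x\<close>.\<close>

lemma sq_integrable_approx_bounded_support:
  assumes h: "sq_integrable h" and e: "e > 0"
  obtains n :: nat where
    "(LINT x|lborel. (cmod (h x - (if \<bar>x\<bar> \<le> n \<and> cmod (h x) \<le> n then h x else 0)))\<^sup>2) < e"
proof -
  note [measurable] = sq_integrable_measurable[OF h]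
  have "(\<lambda>n::nat. LINT x|lborel. (cmod (h x - (if \<bar>x\<bar> \<le> n \<and> cmod (h x) \<le> n then h x else 0)))\<^sup>2)
     \<longlonglongrightarrow> (LINT x|(lborel::real measure). 0)"
  proof (rule integral_dominated_convergence)
    show "integrable lborel (\<lambda>t. (cmod (h t))\<^sup>2)" using h by (rule sq_integrable_norm)
    show "AE x in lborel. (\<lambda>n::nat. (cmod (h x - (if \<bar>x\<bar> \<le> n \<and> cmod (h x) \<le> n then h x else 0)))\<^sup>2) \<longlonglongrightarrow> 0"
    proof (rule AE_I2, rule tendsto_eventually)
      fix x
      obtain m :: nat where "max \<bar>x\<bar> (cmod (h x)) \<le> m" using real_arch_simple by blast
      then show "\<forall>\<^sub>F n::nat in sequentially. (cmod (h x - (if \<bar>x\<bar> \<le> n \<and> cmod (h x) \<le> n then h x else 0)))\<^sup>2 = 0"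
        by (intro eventually_sequentiallyI[of m]) auto
    qed
  qed auto
  then have "\<forall>\<^sub>F n::nat in sequentially. (LINT x|lborel. (cmod (h x - (if \<bar>x\<bar> \<le> n \<and> cmod (h x) \<le> n then h x else 0)))\<^sup>2) < e"
    using e by (intro order_tendstoD(2)) auto
  then show thesis by (rule that[OF someI_ex[OF eventually_happens'[OF sequentially_bot]]])
qed

text \<open>A measurable function is almost everywhere a limit of continuous functions. These need
  not be uniformly bounded or supported, so they are clipped and cut off by operations that fix
  \<open>h\<close>; dominated convergence then gives the approximation.\<close>

lemma bounded_support_approx_continuous:
  assumes h[measurable]: "h \<in> borel_measurable borel" and n: "n > 0" and e: "e > 0"
    and bound: "\<And>x. cmod (h x) \<le> n" and supp: "\<And>x. \<bar>x\<bar> > n \<Longrightarrow> h x = 0"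
  obtains g where "continuous_on UNIV g" "\<And>x. cmod (g x) \<le> n" "sq_integrable g"
    "integrable lborel (\<lambda>x. (cmod (h x - g x))\<^sup>2)"
    "(LINT x|lborel. (cmod (h x - g x))\<^sup>2) < e"
proof -
  have "h measurable_on UNIV"
    using measurable_completion[of h lborel borel]
    by (intro lebesgue_measurable_imp_measurable_on) auto
  then obtain N p where N: "negligible N" and p: "\<And>k::nat. continuous_on UNIV (p k)"
    and lim: "\<And>x. x \<notin> N \<Longrightarrow> (\<lambda>k. p k x) \<longlonglongrightarrow> h x"
    unfolding measurable_on_def by auto
  \<comment> \<open>\<open>clip\<close> is the radial retraction onto the disc of radius
    \<open>n\<close>, and \<open>cut\<close> is 1 on \<open>[-n, n]\<close> and falls linearly to 0
    at distance \<open>n + 1\<close>. Both are continuous.\<close>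
  define clip where "clip z = z * of_real (n / max n (cmod z))" for z :: complex
  define cut where "cut x = max 0 (min 1 (n + 1 - \<bar>x\<bar>))" for x :: real
  define g where "g k x = of_real (cut x) * clip (p k x)" for k x
  have clip_cont: "continuous_on UNIV clip"
    unfolding clip_def using n
    by (intro continuous_intros) (metis less_max_iff_disj less_irrefl)
  have clip_bound: "cmod (clip z) \<le> n" for z
    using n by (auto simp: clip_def norm_mult norm_divide max_def field_simps)
  have clip_h: "of_real (cut x) * clip (h x) = h x" for x
    using n bound[of x] supp[of x] by (cases "\<bar>x\<bar> > n") (auto simp: clip_def cut_def max_def)
  have g_cont: "continuous_on UNIV (g k)" for k
    unfolding g_def cut_def
    by (intro continuous_intros continuous_on_compose2[OF clip_cont p]) auto
  then have [measurable]: "g k \<in> borel_measurable borel" for k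
    by (rule borel_measurable_continuous_onI)
  have g_bound: "cmod (g k x) \<le> n" for k x
  proof -
    have "cmod (g k x) \<le> 1 * n" unfolding g_def norm_mult
      using clip_bound by (intro mult_mono) (auto simp: cut_def)
    then show ?thesis by simp
  qed
  have g_supp: "g k x = 0" if "\<bar>x\<bar> > n + 1" for k x using that by (simp add: g_def cut_def)
  \<comment> \<open>Both \<open>h\<close> and \<open>g k\<close> take values in the disc of radius
    \<open>n\<close>, hence the bound \<open>2 * n\<close> on the difference. The same majorant
    later shows that \<open>g k\<close> is square integrable.\<close>
  let ?w = "\<lambda>x. (2 * n)\<^sup>2 * indicator {- (n + 1)..n + 1} x :: real"
  have w: "integrable lborel ?w" by (intro integrable_mult_right integrable_real_indicator)
      (simp_all add: emeasure_lborel_Icc_eq)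
  have dom: "(cmod (h x - g k x))\<^sup>2 \<le> ?w x" for k x
  proof (cases "\<bar>x\<bar> > n + 1")
    case True then show ?thesis using g_supp[of x] supp[of x] by simp
  next
    case False
    have "cmod (h x - g k x) \<le> 2 * n"
      using norm_triangle_ineq4[of "h x" "g k x"] bound[of x] g_bound[of k x] by simp
    then have "(cmod (h x - g k x))\<^sup>2 \<le> (2 * n)\<^sup>2" by (intro power_mono) auto
    then show ?thesis using False by (auto simp: indicator_def abs_le_iff)
  qed
  have "(\<lambda>k. LINT x|lborel. (cmod (h x - g k x))\<^sup>2) \<longlonglongrightarrow> (LINT x|(lborel::real measure). 0)"
  proof (rule integral_dominated_convergence[OF _ _ w])
    have "AE x in lebesgue. x \<notin> N"
      using N by (simp add: negligible_iff_null_sets AE_not_in)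
    then have "AE x in lborel. x \<notin> N" by (simp add: AE_completion_iff)
    then show "AE x in lborel. (\<lambda>k. (cmod (h x - g k x))\<^sup>2) \<longlonglongrightarrow> 0"
    proof eventually_elim
      case (elim x)
      have "isCont clip (h x)" using clip_cont by (simp add: continuous_on_eq_continuous_at)
      then have "(\<lambda>k. clip (p k x)) \<longlonglongrightarrow> clip (h x)"
        using lim[OF elim] by (rule isCont_tendsto_compose)
      then have "(\<lambda>k. g k x) \<longlonglongrightarrow> h x"
        unfolding g_def by (subst clip_h[symmetric]) (intro tendsto_intros)
      then have "(\<lambda>k. (cmod (h x - g k x))\<^sup>2) \<longlonglongrightarrow> (cmod (h x - h x))\<^sup>2"
        by (intro tendsto_intros)
      then show ?case by simp
    qed
  qed (use dom in auto)
  then have "\<forall>\<^sub>F k in sequentially. (LINT x|lborel. (cmod (h x - g k x))\<^sup>2) < e"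
    using e by (intro order_tendstoD(2)) auto
  then obtain k where k: "(LINT x|lborel. (cmod (h x - g k x))\<^sup>2) < e"
    by (auto dest: eventually_happens'[OF sequentially_bot])
  show thesis
  proof (rule that[of "g k"])
    have "(cmod (g k x))\<^sup>2 \<le> ?w x" for x
    proof (cases "\<bar>x\<bar> > n + 1")
      case False
      have "(cmod (g k x))\<^sup>2 \<le> (2 * n)\<^sup>2" using g_bound[of k x] n by (intro power_mono) auto
      then show ?thesis using False by (auto simp: indicator_def abs_le_iff)
    qed (simp add: g_supp)
    then show "sq_integrable (g k)" unfolding sq_integrable_def
      by (auto intro!: Bochner_Integration.integrable_bound[OF w])
    show "integrable lborel (\<lambda>x. (cmod (h x - g k x))\<^sup>2)"
      using dom by (auto intro!: Bochner_Integration.integrable_bound[OF w])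
  qed (use g_cont g_bound k in auto)
qed

lemma norm_add_square_le: "(cmod (x + y))\<^sup>2 \<le> 2 * (cmod x)\<^sup>2 + 2 * (cmod y)\<^sup>2"
proof -
  have "(cmod (x + y))\<^sup>2 \<le> (cmod x + cmod y)\<^sup>2"
    by (intro power_mono norm_triangle_ineq) auto
  also have "\<dots> \<le> 2 * (cmod x)\<^sup>2 + 2 * (cmod y)\<^sup>2"
    using sum_squares_bound[of "cmod x" "cmod y"] by (simp add: power2_sum)
  finally show ?thesis .
qed

lemma sq_integrable_diff:
  assumes "sq_integrable f" "sq_integrable g"
  shows "sq_integrable (\<lambda>x. f x - g x)"
proof -
  have "(cmod (x - y))\<^sup>2 \<le> 2 * (cmod x)\<^sup>2 + 2 * (cmod y)\<^sup>2" for x y :: complex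
    using norm_add_square_le[of x "- y"] by simp
  moreover have "integrable lborel (\<lambda>x. 2 * (cmod (f x))\<^sup>2 + 2 * (cmod (g x))\<^sup>2)"
    using assms by (auto simp: sq_integrable_def)
  ultimately have "integrable lborel (\<lambda>x. (cmod (f x - g x))\<^sup>2)"
    using assms by (elim Bochner_Integration.integrable_bound) (auto simp: sq_integrable_def)
  then show ?thesis using assms by (auto simp: sq_integrable_def)
qed

lemma sq_integrable_approx_continuous:
  assumes h: "sq_integrable h" and e: "e > 0"
  obtains g B where "continuous_on UNIV g" "\<And>x. cmod (g x) \<le> B" "sq_integrable g"
    "(LINT x|lborel. (cmod (h x - g x))\<^sup>2) < e"
proof -
  note [measurable] = sq_integrable_measurable[OF h]
  \<comment> \<open>Two errors below \<open>e / 4\<close> occur, and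
    \<open>norm_add_square_le\<close> doubles each of them.\<close>
  obtain n :: nat where n: "(LINT x|lborel. (cmod (h x - (if \<bar>x\<bar> \<le> n \<and> cmod (h x) \<le> n then h x else 0)))\<^sup>2) < e / 4"
    using sq_integrable_approx_bounded_support[OF h, of "e / 4"] e by auto
  define q where "q x = (if \<bar>x\<bar> \<le> n \<and> cmod (h x) \<le> n then h x else 0)" for x :: real
  have q_meas[measurable]: "q \<in> borel_measurable borel" unfolding q_def by measurable
  have q: "sq_integrable q" unfolding sq_integrable_def
    by (auto intro!: Bochner_Integration.integrable_bound[OF sq_integrable_norm[OF h]] simp: q_def)
  \<comment> \<open>The radius is \<open>n + 1\<close> because \<open>n\<close> may be 0 and a
    positive radius is required.\<close>
  have "real n + 1 > 0" "e / 4 > 0" "\<And>x. cmod (q x) \<le> real n + 1"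
    "\<And>x. \<bar>x\<bar> > real n + 1 \<Longrightarrow> q x = 0"
    using e by (auto simp: q_def)
  from bounded_support_approx_continuous[OF q_meas this]
  obtain g where g: "continuous_on UNIV g" "\<And>x. cmod (g x) \<le> real n + 1" "sq_integrable g"
    "integrable lborel (\<lambda>x. (cmod (q x - g x))\<^sup>2)"
    "(LINT x|lborel. (cmod (q x - g x))\<^sup>2) < e / 4"
    by blast
  have i: "integrable lborel (\<lambda>x. (cmod (h x - q x))\<^sup>2)"
    using sq_integrable_norm[OF sq_integrable_diff[OF h q]] .
  have "(LINT x|lborel. (cmod (h x - g x))\<^sup>2)
      \<le> (LINT x|lborel. 2 * (cmod (h x - q x))\<^sup>2 + 2 * (cmod (q x - g x))\<^sup>2)"
  proof (rule integral_mono)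
    show "integrable lborel (\<lambda>x. (cmod (h x - g x))\<^sup>2)"
      using sq_integrable_norm[OF sq_integrable_diff[OF h g(3)]] .
    show "(cmod (h x - g x))\<^sup>2 \<le> 2 * (cmod (h x - q x))\<^sup>2 + 2 * (cmod (q x - g x))\<^sup>2" for x
      using norm_add_square_le[of "h x - q x" "q x - g x"] by simp
  qed (use i g in auto)
  also have "\<dots> = 2 * (LINT x|lborel. (cmod (h x - q x))\<^sup>2) + 2 * (LINT x|lborel. (cmod (q x - g x))\<^sup>2)"
    using i g by simp
  also have "\<dots> < e" using n g(5) unfolding q_def by simp
  finally show thesis using that g(1-3) by blast
qed

text \<open>Replacing \<open>h\<close> by a bounded continuous \<open>g\<close> costs an error
  uniform in \<open>r\<close>, since translation preserves the L2 norm. For \<open>g\<close> the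
  limit is dominated convergence with majorant \<open>B * cmod (k t)\<close>, which uses that
  \<open>k\<close> is integrable.\<close>

lemma correlation_tendsto:
  assumes h: "sq_integrable h" and k: "sq_integrable k" and k1: "integrable lborel k"
  shows "((\<lambda>r. LINT t|lborel. h (t + r) * k t) \<longlongrightarrow> (LINT t|lborel. h t * k t)) (at 0)"
proof (rule tendstoI)
  fix e :: real assume e: "e > 0"
  note [measurable] = sq_integrable_measurable[OF h] sq_integrable_measurable[OF k]
  define K where "K = (LINT t|lborel. (cmod (k t))\<^sup>2)"
  have K: "K \<ge> 0" unfolding K_def by simp
  \<comment> \<open>This weight makes \<open>l * K / 2\<close> at most \<open>e / 6\<close>;
    approximating \<open>h\<close> within \<open>e / 3 * l\<close> then makes the other term less
    than \<open>e / 6\<close>. The summand 1 covers \<open>K = 0\<close>.\<close>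
  define l where "l = e / 3 / (K + 1)"
  have l: "l > 0" using e K by (simp add: l_def)
  obtain g B where g: "continuous_on UNIV g" "\<And>x. cmod (g x) \<le> B" "sq_integrable g"
    and gh: "(LINT x|lborel. (cmod (h x - g x))\<^sup>2) < e / 3 * l"
    using sq_integrable_approx_continuous[OF h, of "e / 3 * l"] e l by auto
  note [measurable] = sq_integrable_measurable[OF g(3)]
  have close: "cmod ((LINT t|lborel. h (t + r) * k t) - (LINT t|lborel. g (t + r) * k t)) < e / 3" for r
  proof -
    let ?D = "LINT t|lborel. (cmod (h t - g t))\<^sup>2"
    have "(LINT t|lborel. h (t + r) * k t) - (LINT t|lborel. g (t + r) * k t)
        = (LINT t|lborel. (h (t + r) - g (t + r)) * k t)"
      unfolding left_diff_distrib
      by (intro Bochner_Integration.integral_diff[symmetric] sq_integrable_mult sq_integrable_shift h g k)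
    also have "cmod \<dots> \<le> (LINT t|lborel. (cmod (h (t + r) - g (t + r)))\<^sup>2) / (2 * l) + l * K / 2"
      unfolding K_def
      by (intro norm_integral_mult_le sq_integrable_diff sq_integrable_shift h g k l)
    also have "(LINT t|lborel. (cmod (h (t + r) - g (t + r)))\<^sup>2) = ?D"
      by (rule integral_shift)
    also have "?D / (2 * l) < e / 6" using gh l by (simp add: field_simps)
    also have "l * K / 2 \<le> e / 6" using K e by (simp add: l_def field_simps)
    finally show ?thesis by simp
  qed
  have "((\<lambda>r. LINT t|lborel. g (t + r) * k t) \<longlongrightarrow> (LINT t|lborel. g t * k t)) (at 0)"
  proof (subst tendsto_at_iff_sequentially, intro allI impI, unfold o_def)
    fix X :: "nat \<Rightarrow> real" assume X: "X \<longlonglongrightarrow> 0"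
    show "(\<lambda>n. LINT t|lborel. g (t + X n) * k t) \<longlonglongrightarrow> (LINT t|lborel. g t * k t)"
    proof (rule integral_dominated_convergence)
      show "integrable lborel (\<lambda>t. B * cmod (k t))" using k1 by simp
      show "AE t in lborel. (\<lambda>n. g (t + X n) * k t) \<longlonglongrightarrow> g t * k t"
      proof (intro always_eventually allI tendsto_mult tendsto_const)
        fix t
        have "(\<lambda>n. t + X n) \<longlonglongrightarrow> t + 0" by (intro tendsto_add tendsto_const X)
        then have "(\<lambda>n. t + X n) \<longlonglongrightarrow> t" by simp
        moreover have "isCont g t" using g(1) by (simp add: continuous_on_eq_continuous_at)
        ultimately show "(\<lambda>n. g (t + X n)) \<longlonglongrightarrow> g t" by (rule isCont_tendsto_compose[rotated])
      qed
      show "AE t in lborel. cmod (g (t + X n) * k t) \<le> B * cmod (k t)" for n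
        using g(2) by (auto simp: norm_mult intro!: mult_right_mono)
    qed auto
  qed
  then have "\<forall>\<^sub>F r in at 0. dist (LINT t|lborel. g (t + r) * k t) (LINT t|lborel. g t * k t) < e / 3"
    using e by (intro tendstoD) auto
  then show "\<forall>\<^sub>F r in at 0. dist (LINT t|lborel. h (t + r) * k t) (LINT t|lborel. h t * k t) < e"
  proof eventually_elim
    case (elim r)
    let ?H = "\<lambda>r. LINT t|lborel. h (t + r) * k t" and ?G = "\<lambda>r. LINT t|lborel. g (t + r) * k t"
    have "dist (?H r) (?H 0) \<le> dist (?H r) (?G r) + (dist (?G r) (?G 0) + dist (?G 0) (?H 0))"
      by (rule order_trans[OF dist_triangle[of _ _ "?G r"]]) (intro add_left_mono dist_triangle)
    also have "\<dots> < e / 3 + (e / 3 + e / 3)"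
      using elim close[of r] close[of 0] by (intro add_strict_mono) (simp_all add: dist_norm norm_minus_commute)
    finally show ?case by simp
  qed
qed

subsection \<open>The Plancherel identity on the intersection of L1 and L2\<close>

text \<open>Angular frequency and no normalising factor, hence the \<open>2 * pi\<close> in
  \<open>plancherel\<close>.\<close>

definition fourier :: "(real \<Rightarrow> complex) \<Rightarrow> real \<Rightarrow> complex" where
  "fourier h u = (LINT t|lborel. h t * cis (- (u * t)))"

lemma borel_measurable_cis [measurable (raw)]:
  "f \<in> borel_measurable M \<Longrightarrow> (\<lambda>x. cis (f x)) \<in> borel_measurable M"
  by (rule measurable_compose[OF _ borel_measurable_continuous_onI[OF continuous_on_cis[OF continuous_on_id]]])

lemma borel_measurable_fourier [measurable (raw)]:
  assumes [measurable]: "h \<in> borel_measurable borel"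
  shows "fourier h \<in> borel_measurable borel"
proof -
  have "(\<lambda>u. LINT t|lborel. h t * cis (- (u * t))) \<in> borel_measurable lborel" by measurable
  then show ?thesis by (simp add: fourier_def[abs_def])
qed

lemma norm_fourier_le: "cmod (fourier h u) \<le> (LINT t|lborel. cmod (h t))"
  unfolding fourier_def by (rule order_trans[OF integral_norm_bound]) (simp add: norm_mult)

lemma integrable_mult_cis:
  assumes "integrable M h" and [measurable]: "g \<in> borel_measurable M"
  shows "integrable M (\<lambda>t. h t * cis (g t))"
  by (rule Bochner_Integration.integrable_bound[OF assms(1)]) (use assms in \<open>auto simp: norm_mult\<close>)

text \<open>Read off from the characteristic function of the standard normal law after rescaling.
  The right-hand side is \<open>sqrt (2 * pi)\<close> times the normal density of standard deviation
  \<open>\<epsilon>\<close>, the approximate identity used below.\<close>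

lemma gaussian_fourier:
  assumes "\<epsilon> > 0"
  shows "(LINT u|lborel. of_real (std_normal_density (\<epsilon> * u)) * cis (- (u * r)))
     = complex_of_real (sqrt (2 * pi) / \<epsilon> * std_normal_density (r / \<epsilon>))"
proof -
  \<comment> \<open>Chosen so that the substitution \<open>x = \<epsilon> * u\<close> turns the
    phase \<open>?t * x\<close> into \<open>- (u * r)\<close>.\<close>
  let ?t = "- (r / \<epsilon>)"
  have "complex_of_real (exp (- (?t\<^sup>2) / 2)) = char std_normal_distribution ?t"
    by (simp add: char_std_normal_distribution)
  also have "\<dots> = (LINT x|lborel. std_normal_density x *\<^sub>R iexp (?t * x))"
    unfolding char_def by (subst integral_density) (auto intro!: borel_measurable_continuous_onI continuous_intros)
  also have "\<dots> = \<epsilon> *\<^sub>R (LINT u|lborel. std_normal_density (0 + \<epsilon> * u) *\<^sub>R iexp (?t * (0 + \<epsilon> * u)))"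
    using assms by (subst lborel_integral_real_affine[of \<epsilon> _ 0]) auto
  also have "(\<lambda>u. std_normal_density (0 + \<epsilon> * u) *\<^sub>R iexp (?t * (0 + \<epsilon> * u)))
      = (\<lambda>u. of_real (std_normal_density (\<epsilon> * u)) * cis (- (u * r)))"
    using assms by (auto simp: fun_eq_iff scaleR_conv_of_real cis_conv_exp mult.commute)
  finally have "(LINT u|lborel. of_real (std_normal_density (\<epsilon> * u)) * cis (- (u * r)))
      = complex_of_real (exp (- (?t\<^sup>2) / 2)) / \<epsilon>"
    using assms by (simp add: scaleR_conv_of_real field_simps)
  then show ?thesis by (simp add: std_normal_density_def)
qed

lemma integrable_std_normal_density_scale:
  assumes "\<epsilon> > 0"
  shows "integrable lborel (\<lambda>u. std_normal_density (\<epsilon> * u))"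
  using assms lborel_integrable_real_affine[of std_normal_density \<epsilon> 0] by simp

lemma (in pair_sigma_finite) integrable_mult_pair:
  fixes f g :: "_ \<Rightarrow> 'c :: {real_normed_field, banach, second_countable_topology}"
  assumes [measurable]: "integrable M1 f" "integrable M2 g"
  shows "integrable (M1 \<Otimes>\<^sub>M M2) (\<lambda>(x, y). f x * g y)"
proof (rule Fubini_integrable)
  show "integrable M1 (\<lambda>x. LINT y|M2. norm (case (x, y) of (x, y) \<Rightarrow> f x * g y))"
    using assms by (simp add: norm_mult)
  show "AE x in M1. integrable M2 (\<lambda>y. case (x, y) of (x, y) \<Rightarrow> f x * g y)"
    using assms by simp
qed measurable

text \<open>The weighted inequality at weight 1 and translation invariance. The bound is independent
  of \<open>r\<close> and so serves as a majorant for Fubini and for dominated convergence.\<close>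

lemma norm_correlation_le:
  assumes h: "sq_integrable h" and k: "sq_integrable k"
  shows "(LINT t|lborel. cmod (h (t + r) * k t))
     \<le> (LINT t|lborel. (cmod (h t))\<^sup>2) / 2 + (LINT t|lborel. (cmod (k t))\<^sup>2) / 2"
proof -
  have "(LINT t|lborel. cmod (h (t + r) * k t))
     \<le> (LINT t|lborel. (cmod (h (t + r)))\<^sup>2 / (2 * 1) + 1 * (cmod (k t))\<^sup>2 / 2)"
    using sq_integrable_mult[OF sq_integrable_shift[OF h] k] h k sq_integrable_shift[OF h]
    by (intro integral_mono integrable_norm norm_mult_le_weighted) (auto simp: sq_integrable_def)
  also have "\<dots> = (LINT t|lborel. (cmod (h (t + r)))\<^sup>2) / 2 + (LINT t|lborel. (cmod (k t))\<^sup>2) / 2"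
    using sq_integrable_shift[OF h] k by (simp add: sq_integrable_def)
  also have "(LINT t|lborel. (cmod (h (t + r)))\<^sup>2) = (LINT t|lborel. (cmod (h t))\<^sup>2)"
    by (rule integral_shift)
  finally show ?thesis .
qed

lemma std_normal_density_le: "std_normal_density x \<le> 1 / sqrt (2 * pi)"
  by (simp add: std_normal_density_def divide_right_mono)

text \<open>
  Fubini turns the Gaussian-weighted pairing of the transforms into an average of the
  correlation of \<open>h\<close> and \<open>k\<close> over a normal distribution of standard deviation \<open>\<epsilon>\<close>.
\<close>
lemma gaussian_plancherel:
  assumes h: "sq_integrable h" "integrable lborel h"
    and k: "sq_integrable k" "integrable lborel k" and \<epsilon>: "\<epsilon> > 0"
  shows "(LINT u|lborel. of_real (std_normal_density (\<epsilon> * u)) * (fourier h u * cnj (fourier k u)))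
    = of_real (sqrt (2 * pi)) * (LINT x|lborel. of_real (std_normal_density x) * (LINT t|lborel. h (t + \<epsilon> * x) * cnj (k t)))"
proof -
  note [measurable] = sq_integrable_measurable[OF h(1)] sq_integrable_measurable[OF k(1)]
  let ?G = "\<lambda>u. complex_of_real (std_normal_density (\<epsilon> * u))"
  \<comment> \<open>Pairing the variables \<open>t\<close> of \<open>k\<close> and \<open>s\<close>
    of \<open>h\<close> makes the triple integral a two-factor one, so that a single Fubini exchange
    moves \<open>u\<close> inside.\<close>
  define \<Phi> where "\<Phi> = (\<lambda>(t, s). cnj (k t) * h s)"
  have \<Phi>: "integrable lborel \<Phi>"
    unfolding \<Phi>_def lborel_prod[symmetric]
    using lborel_pair.integrable_mult_pair[of "\<lambda>t. cnj (k t)" h] h k by simp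
  have [measurable]: "\<Phi> \<in> borel_measurable borel" using borel_measurable_integrable[OF \<Phi>] by simp
  have G: "integrable lborel ?G"
    using integrable_std_normal_density_scale[OF \<epsilon>] by simp
  let ?F = "\<lambda>u p. ?G u * (\<Phi> p * cis (- (u * (snd p - fst p))))"
  have F: "integrable (lborel \<Otimes>\<^sub>M lborel) (case_prod ?F)"
  proof (rule Bochner_Integration.integrable_bound[OF lborel_pair.integrable_mult_pair[OF G \<Phi>]])
    \<comment> \<open>Measurability is proved for the Borel sets of the triple product, where
      projections are continuous maps.\<close>
    have [measurable]: "(snd :: real \<times> real \<times> real \<Rightarrow> _) \<in> borel \<rightarrow>\<^sub>M borel"
      "(fst :: real \<times> real \<times> real \<Rightarrow> _) \<in> borel \<rightarrow>\<^sub>M borel"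
      "(fst :: real \<times> real \<Rightarrow> _) \<in> borel \<rightarrow>\<^sub>M borel" "(snd :: real \<times> real \<Rightarrow> _) \<in> borel \<rightarrow>\<^sub>M borel"
      by (intro borel_measurable_continuous_onI continuous_intros)+
    have "case_prod ?F \<in> borel_measurable borel"
      unfolding case_prod_beta' by measurable
    then show "case_prod ?F \<in> borel_measurable (lborel \<Otimes>\<^sub>M lborel)"
      by (simp add: lborel_prod)
  qed (auto simp: norm_mult)
  have "fourier h u * cnj (fourier k u) = (LINT p|lborel. \<Phi> p * cis (- (u * (snd p - fst p))))" for u
  proof -
    have eq: "\<Phi> p * cis (- (u * (snd p - fst p)))
        = (\<lambda>(t, s). cnj (k t * cis (- (u * t))) * (h s * cis (- (u * s)))) p" for p
    proof (cases p)
      case (Pair t s)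
      have "cis (- (u * (s - t))) = cis (u * t) * cis (- (u * s))"
        by (simp add: cis_mult algebra_simps)
      then show ?thesis by (simp add: Pair \<Phi>_def cis_cnj)
    qed
    have hk: "integrable lborel (\<lambda>s. h s * cis (- (u * s)))" "integrable lborel (\<lambda>t. cnj (k t * cis (- (u * t))))"
      using h k by (auto intro!: integrable_mult_cis integrable_cnj simp del: complex_cnj_mult)
    have "(LINT p|lborel. \<Phi> p * cis (- (u * (snd p - fst p)))) =
       (LINT t|lborel. LINT s|lborel. cnj (k t * cis (- (u * t))) * (h s * cis (- (u * s))))"
      unfolding eq lborel_prod[symmetric]
      by (rule lborel_pair.integral_fst[symmetric]) (rule lborel_pair.integrable_mult_pair[OF hk(2,1)])
    also have "\<dots> = (LINT t|lborel. cnj (k t * cis (- (u * t)))) * fourier h u"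
      by (simp add: fourier_def del: complex_cnj_mult)
    also have "(LINT t|lborel. cnj (k t * cis (- (u * t)))) = cnj (fourier k u)"
      unfolding fourier_def by (rule Bochner_Integration.integral_cnj)
    finally show ?thesis by (simp add: mult.commute)
  qed
  then have "(LINT u|lborel. ?G u * (fourier h u * cnj (fourier k u))) = (LINT u|lborel. LINT p|lborel. ?F u p)"
    by simp
  also have "\<dots> = (LINT p|lborel. LINT u|lborel. ?F u p)"
    by (rule lborel_pair.Fubini_integral[OF F, symmetric])
  \<comment> \<open>For fixed \<open>(t, s)\<close> the integral over \<open>u\<close> is the
    Gaussian transform at \<open>s - t\<close>.\<close>
  also have "(\<lambda>p. LINT u|lborel. ?F u p)
      = (\<lambda>(t, s). cnj (k t) * h s * of_real (sqrt (2 * pi) / \<epsilon> * std_normal_density ((s - t) / \<epsilon>)))"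
  proof (rule ext, rule prod.induct)
    fix t s
    have "(LINT u|lborel. ?G u * (\<Phi> (t, s) * cis (- (u * (s - t)))))
       = (LINT u|lborel. \<Phi> (t, s) * (?G u * cis (- (u * (s - t)))))"
      by (simp add: mult_ac)
    also have "\<dots> = \<Phi> (t, s) * (LINT u|lborel. ?G u * cis (- (u * (s - t))))"
      by (rule integral_mult_right_zero)
    finally show "(LINT u|lborel. ?F u (t, s)) = (case (t, s) of (t, s) \<Rightarrow>
         cnj (k t) * h s * of_real (sqrt (2 * pi) / \<epsilon> * std_normal_density ((s - t) / \<epsilon>)))"
      unfolding gaussian_fourier[OF \<epsilon>] by (simp add: \<Phi>_def)
  qed
  also have "(LINT p|lborel. (\<lambda>(t, s). cnj (k t) * h s * of_real (sqrt (2 * pi) / \<epsilon> * std_normal_density ((s - t) / \<epsilon>))) p)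
     = (LINT t|lborel. LINT s|lborel. cnj (k t) * h s * of_real (sqrt (2 * pi) / \<epsilon> * std_normal_density ((s - t) / \<epsilon>)))"
    unfolding lborel_prod[symmetric]
  proof (rule lborel_pair.integral_fst[symmetric])
    \<comment> \<open>The weight is bounded, by the maximum of the normal density, so integrability
      of \<open>\<Phi>\<close> carries over.\<close>
    let ?C = "sqrt (2 * pi) / \<epsilon> * (1 / sqrt (2 * pi))"
    have C: "\<bar>sqrt (2 * pi) / \<epsilon> * std_normal_density x\<bar> \<le> ?C" for x
    proof -
      have "sqrt (2 * pi) / \<epsilon> \<ge> 0" using \<epsilon> by simp
      then show ?thesis
        by (subst abs_of_nonneg) (intro mult_left_mono mult_nonneg_nonneg std_normal_density_le normal_density_nonneg; assumption)+
    qed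
    show "integrable (lborel \<Otimes>\<^sub>M lborel) (\<lambda>(t, s). cnj (k t) * h s * of_real (sqrt (2 * pi) / \<epsilon> * std_normal_density ((s - t) / \<epsilon>)))"
    proof (rule Bochner_Integration.integrable_bound)
      show "integrable (lborel \<Otimes>\<^sub>M lborel) (\<lambda>p. \<Phi> p * of_real ?C)"
        using \<Phi> unfolding lborel_prod[symmetric] by (intro integrable_mult_left)
      show "AE p in lborel \<Otimes>\<^sub>M lborel. cmod (case p of (t, s) \<Rightarrow> cnj (k t) * h s * of_real (sqrt (2 * pi) / \<epsilon> * std_normal_density ((s - t) / \<epsilon>)))
          \<le> norm (\<Phi> p * of_real ?C)"
      proof (rule AE_I2, rule prod.induct)
        fix t s
        have "\<bar>sqrt (2 * pi) / \<epsilon> * std_normal_density ((s - t) / \<epsilon>)\<bar> \<le> \<bar>?C\<bar>"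
          by (rule order_trans[OF C abs_ge_self])
        then show "cmod (case (t, s) of (t, s) \<Rightarrow> cnj (k t) * h s * of_real (sqrt (2 * pi) / \<epsilon> * std_normal_density ((s - t) / \<epsilon>)))
          \<le> norm (\<Phi> (t, s) * of_real ?C)"
          unfolding \<Phi>_def prod.case norm_mult[of "cnj (k t) * h s"] norm_of_real
          by (intro mult_left_mono norm_ge_zero)
      qed
    qed measurable
  qed
  \<comment> \<open>Substitution \<open>s = t + \<epsilon> * x\<close>, whose Jacobian cancels the
    factor \<open>1 / \<epsilon>\<close>.\<close>
  also have "\<dots> = (LINT t|lborel. LINT x|lborel. cnj (k t) * h (t + \<epsilon> * x) * of_real (sqrt (2 * pi) * std_normal_density x))"
  proof (rule Bochner_Integration.integral_cong[OF refl])
    fix t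
    let ?f = "\<lambda>s. cnj (k t) * h s * of_real (sqrt (2 * pi) / \<epsilon> * std_normal_density ((s - t) / \<epsilon>))"
    have "(LINT s|lborel. ?f s) = \<bar>\<epsilon>\<bar> *\<^sub>R (LINT x|lborel. ?f (t + \<epsilon> * x))"
      by (rule lborel_integral_real_affine) (use \<epsilon> in simp)
    also have "\<dots> = (LINT x|lborel. \<bar>\<epsilon>\<bar> *\<^sub>R ?f (t + \<epsilon> * x))"
      by (rule Bochner_Integration.integral_scaleR_right[symmetric])
    also have "\<dots> = (LINT x|lborel. cnj (k t) * h (t + \<epsilon> * x) * of_real (sqrt (2 * pi) * std_normal_density x))"
      by (rule Bochner_Integration.integral_cong[OF refl]) (use \<epsilon> in \<open>simp add: scaleR_conv_of_real\<close>)
    finally show "(LINT s|lborel. ?f s)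
       = (LINT x|lborel. cnj (k t) * h (t + \<epsilon> * x) * of_real (sqrt (2 * pi) * std_normal_density x))" .
  qed
  also have "\<dots> = (LINT x|lborel. LINT t|lborel. cnj (k t) * h (t + \<epsilon> * x) * of_real (sqrt (2 * pi) * std_normal_density x))"
  proof (rule lborel_pair.Fubini_integral)
    let ?K = "\<lambda>x t. cnj (k t) * h (t + \<epsilon> * x) * of_real (sqrt (2 * pi) * std_normal_density x)"
    \<comment> \<open>For each \<open>x\<close> the norm of the correlation integrand integrates
      over \<open>t\<close> to at most \<open>?B\<close>, independently of \<open>x\<close>; the
      Gaussian then makes the integral over \<open>x\<close> finite.\<close>
    let ?B = "(LINT t|lborel. (cmod (h t))\<^sup>2) / 2 + (LINT t|lborel. (cmod (cnj (k t)))\<^sup>2) / 2"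
    show "integrable (lborel \<Otimes>\<^sub>M lborel) (case_prod ?K)"
    proof (rule lborel_pair.Fubini_integrable)
      show "case_prod ?K \<in> borel_measurable (lborel \<Otimes>\<^sub>M lborel)" by measurable
      have eq: "cmod (?K x t) = cmod (h (t + \<epsilon> * x) * cnj (k t)) * (sqrt (2 * pi) * std_normal_density x)" for x t
        by (simp add: norm_mult mult_ac)
      show "integrable lborel (\<lambda>x. LINT t|lborel. cmod (case (x, t) of (x, t) \<Rightarrow> ?K x t))"
      proof (rule Bochner_Integration.integrable_bound)
        show "integrable lborel (\<lambda>x. ?B * (sqrt (2 * pi) * std_normal_density x))" by simp
        show "AE x in lborel. norm (LINT t|lborel. cmod (case (x, t) of (x, t) \<Rightarrow> ?K x t)) \<le> norm (?B * (sqrt (2 * pi) * std_normal_density x))"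
        proof (rule AE_I2)
          fix x
          have "(LINT t|lborel. cmod (?K x t)) \<le> ?B * (sqrt (2 * pi) * std_normal_density x)"
            unfolding eq integral_mult_left_zero
            by (intro mult_right_mono norm_correlation_le sq_integrable_cnj h k) auto
          then show "norm (LINT t|lborel. cmod (case (x, t) of (x, t) \<Rightarrow> ?K x t)) \<le> norm (?B * (sqrt (2 * pi) * std_normal_density x))"
            unfolding real_norm_def by (subst abs_of_nonneg) auto
        qed
      qed measurable
      show "AE x in lborel. integrable lborel (\<lambda>t. case (x, t) of (x, t) \<Rightarrow> ?K x t)"
        unfolding prod.case
        by (intro AE_I2 integrable_mult_left sq_integrable_mult sq_integrable_cnj sq_integrable_shift h k)
    qed
  qed
  also have "\<dots> = (LINT x|lborel. of_real (sqrt (2 * pi)) * (of_real (std_normal_density x) * (LINT t|lborel. h (t + \<epsilon> * x) * cnj (k t))))"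
    by (simp add: mult_ac flip: integral_mult_right_zero)
  also have "\<dots> = of_real (sqrt (2 * pi)) * (LINT x|lborel. of_real (std_normal_density x) * (LINT t|lborel. h (t + \<epsilon> * x) * cnj (k t)))"
    by (rule integral_mult_right_zero)
  finally show ?thesis .
qed

text \<open>The averaging law has standard deviation \<open>1 / (n + 1)\<close> and total mass 1, so
  it concentrates at 0, where the correlation is continuous. Its uniform bound gives the
  majorant.\<close>

lemma gaussian_plancherel_limit:
  assumes h: "sq_integrable h" "integrable lborel h"
    and k: "sq_integrable k" "integrable lborel k"
  shows "(\<lambda>n. LINT u|lborel. of_real (std_normal_density (1 / real (Suc n) * u)) * (fourier h u * cnj (fourier k u)))
    \<longlonglongrightarrow> of_real (sqrt (2 * pi)) * (LINT t|lborel. h t * cnj (k t))"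
proof -
  note [measurable] = sq_integrable_measurable[OF h(1)] sq_integrable_measurable[OF k(1)]
  let ?\<gamma> = "\<lambda>r. LINT t|lborel. h (t + r) * cnj (k t)"
  let ?B = "(LINT t|lborel. (cmod (h t))\<^sup>2) / 2 + (LINT t|lborel. (cmod (cnj (k t)))\<^sup>2) / 2"
  have \<gamma>: "(?\<gamma> \<longlongrightarrow> ?\<gamma> 0) (at 0)"
    using correlation_tendsto[OF h(1) sq_integrable_cnj[OF k(1)]] k(2) by simp
  have \<gamma>_cont: "isCont ?\<gamma> 0" unfolding isCont_def by (rule \<gamma>)
  have "(\<lambda>n. LINT x|lborel. complex_of_real (std_normal_density x) * ?\<gamma> (1 / real (Suc n) * x))
      \<longlonglongrightarrow> (LINT x|lborel. of_real (std_normal_density x) * ?\<gamma> 0)"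
  proof (rule integral_dominated_convergence)
    show "integrable lborel (\<lambda>x. std_normal_density x * ?B)" by simp
    show "AE x in lborel. (\<lambda>n. complex_of_real (std_normal_density x) * ?\<gamma> (1 / real (Suc n) * x))
        \<longlonglongrightarrow> of_real (std_normal_density x) * ?\<gamma> 0"
    proof (rule AE_I2)
      fix x :: real
      have "(\<lambda>n. 1 / real (Suc n) * x) \<longlonglongrightarrow> 0 * x"
        by (intro tendsto_mult tendsto_const LIMSEQ_Suc lim_1_over_n)
      then have "(\<lambda>n. 1 / real (Suc n) * x) \<longlonglongrightarrow> 0" by simp
      from isCont_tendsto_compose[OF \<gamma>_cont this]
      show "(\<lambda>n. complex_of_real (std_normal_density x) * ?\<gamma> (1 / real (Suc n) * x))
        \<longlonglongrightarrow> of_real (std_normal_density x) * ?\<gamma> 0"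
        by (intro tendsto_mult tendsto_const)
    qed
    show "AE x in lborel. cmod (complex_of_real (std_normal_density x) * ?\<gamma> (1 / real (Suc n) * x))
        \<le> std_normal_density x * ?B" for n
    proof (rule AE_I2)
      fix x
      have "cmod (?\<gamma> (1 / real (Suc n) * x)) \<le> ?B"
        by (rule order_trans[OF integral_norm_bound norm_correlation_le[OF h(1) sq_integrable_cnj[OF k(1)]]])
      then show "cmod (complex_of_real (std_normal_density x) * ?\<gamma> (1 / real (Suc n) * x)) \<le> std_normal_density x * ?B"
        unfolding norm_mult by (intro mult_mono) auto
    qed
  qed measurable
  also have "(LINT x|lborel. of_real (std_normal_density x) * ?\<gamma> 0) = ?\<gamma> 0"
    by simp
  finally have "(\<lambda>n. of_real (sqrt (2 * pi)) * (LINT x|lborel. complex_of_real (std_normal_density x) * ?\<gamma> (1 / real (Suc n) * x)))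
     \<longlonglongrightarrow> of_real (sqrt (2 * pi)) * ?\<gamma> 0"
    by (intro tendsto_mult tendsto_const)
  then show ?thesis
    by (subst gaussian_plancherel[OF h k]) auto
qed

section \<open>Removal of the Gaussian weight\<close>

lemma std_normal_density_scale_tendsto:
  "(\<lambda>n. std_normal_density (1 / real (Suc n) * u)) \<longlonglongrightarrow> 1 / sqrt (2 * pi)"
proof -
  have "(\<lambda>n. 1 / sqrt (2 * pi) * exp (- (1 / real (Suc n) * u)\<^sup>2 / 2)) \<longlonglongrightarrow> 1 / sqrt (2 * pi) * exp (- (0 * u)\<^sup>2 / 2)"
    by (intro tendsto_intros LIMSEQ_Suc lim_1_over_n) auto
  then show ?thesis unfolding std_normal_density_def by simp
qed

text \<open>With both inputs equal to \<open>h\<close> the weighted integrands are nonnegative and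
  increase with \<open>n\<close>, while their integrals converge to a finite limit. Monotone
  convergence therefore yields integrability without presupposing it.\<close>

lemma sq_integrable_fourier:
  assumes h: "sq_integrable h" "integrable lborel h"
  shows "sq_integrable (fourier h)"
proof -
  note [measurable] = sq_integrable_measurable[OF h(1)]
  let ?f = "\<lambda>n u. std_normal_density (1 / real (Suc n) * u) * (cmod (fourier h u))\<^sup>2"
  have lim: "(\<lambda>n. LINT u|lborel. ?f n u) \<longlonglongrightarrow> Re (of_real (sqrt (2 * pi)) * (LINT t|lborel. h t * cnj (h t)))"
  proof -
    have "(LINT u|lborel. of_real (std_normal_density (1 / real (Suc n) * u)) * (fourier h u * cnj (fourier h u)))
        = complex_of_real (LINT u|lborel. ?f n u)" for n
      by (simp only: complex_norm_square[symmetric] of_real_mult[symmetric] of_real_power[symmetric] integral_complex_of_real)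
    with tendsto_Re[OF gaussian_plancherel_limit[OF h h]] show ?thesis by simp
  qed
  have "integrable lborel (\<lambda>u. 1 / sqrt (2 * pi) * (cmod (fourier h u))\<^sup>2)"
  proof (rule integrable_monotone_convergence[OF _ _ _ lim])
    \<comment> \<open>The transform is bounded by the L1 norm of \<open>h\<close>, so the Gaussian
      alone supplies integrability.\<close>
    show "integrable lborel (?f n)" for n
    proof (rule Bochner_Integration.integrable_bound)
      show "integrable lborel (\<lambda>u. std_normal_density (1 / real (Suc n) * u) * (LINT t|lborel. cmod (h t))\<^sup>2)"
        by (intro integrable_mult_left integrable_std_normal_density_scale) simp
      have "?f n u \<le> std_normal_density (1 / real (Suc n) * u) * (LINT t|lborel. cmod (h t))\<^sup>2" for u
        by (intro mult_left_mono power_mono norm_fourier_le) auto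
      then show "AE u in lborel. norm (?f n u) \<le> norm (std_normal_density (1 / real (Suc n) * u) * (LINT t|lborel. cmod (h t))\<^sup>2)"
        by (intro AE_I2) (simp add: abs_mult)
    qed measurable
    show "AE u in lborel. mono (\<lambda>n. ?f n u)"
    proof (intro AE_I2 monoI mult_right_mono)
      fix u :: real and m n :: nat assume "m \<le> n"
      then have "\<bar>1 / real (Suc n) * u\<bar> \<le> \<bar>1 / real (Suc m) * u\<bar>"
        by (simp add: abs_mult frac_le mult_right_mono)
      then have "(1 / real (Suc n) * u)\<^sup>2 \<le> (1 / real (Suc m) * u)\<^sup>2"
        by (rule abs_le_square_iff[THEN iffD1])
      then show "std_normal_density (1 / real (Suc m) * u) \<le> std_normal_density (1 / real (Suc n) * u)"
        unfolding std_normal_density_def by (intro mult_left_mono) auto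
    qed auto
    show "AE u in lborel. (\<lambda>n. ?f n u) \<longlonglongrightarrow> 1 / sqrt (2 * pi) * (cmod (fourier h u))\<^sup>2"
      by (intro AE_I2 tendsto_mult tendsto_const std_normal_density_scale_tendsto)
  qed measurable
  from integrable_mult_right[OF this, of "sqrt (2 * pi)"]
  show ?thesis unfolding sq_integrable_def by auto
qed

text \<open>The weighted integrals have two limits: dominated convergence gives the integral over
  \<open>u\<close> divided by \<open>sqrt (2 * pi)\<close>, and the correlation argument gives
  \<open>sqrt (2 * pi)\<close> times the inner product. Equating them gives the factor
  \<open>2 * pi\<close>.\<close>

lemma plancherel:
  assumes h: "sq_integrable h" "integrable lborel h"
    and k: "sq_integrable k" "integrable lborel k"
  shows "(LINT u|lborel. fourier h u * cnj (fourier k u)) = of_real (2 * pi) * (LINT t|lborel. h t * cnj (k t))"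
proof -
  note [measurable] = sq_integrable_measurable[OF h(1)] sq_integrable_measurable[OF k(1)]
  let ?P = "\<lambda>u. fourier h u * cnj (fourier k u)"
  have P: "integrable lborel ?P"
    by (intro sq_integrable_mult sq_integrable_cnj sq_integrable_fourier h k)
  have "(\<lambda>n. LINT u|lborel. complex_of_real (std_normal_density (1 / real (Suc n) * u)) * ?P u)
     \<longlonglongrightarrow> (LINT u|lborel. of_real (1 / sqrt (2 * pi)) * ?P u)"
  proof (rule integral_dominated_convergence)
    show "integrable lborel (\<lambda>u. 1 / sqrt (2 * pi) * cmod (?P u))"
      using P by (intro integrable_mult_right integrable_norm)
    show "AE u in lborel. (\<lambda>n. complex_of_real (std_normal_density (1 / real (Suc n) * u)) * ?P u)
       \<longlonglongrightarrow> of_real (1 / sqrt (2 * pi)) * ?P u"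
      by (intro AE_I2 tendsto_mult tendsto_const tendsto_of_real std_normal_density_scale_tendsto)
    show "AE u in lborel. cmod (complex_of_real (std_normal_density (1 / real (Suc n) * u)) * ?P u)
       \<le> 1 / sqrt (2 * pi) * cmod (?P u)" for n
      using std_normal_density_le
      by (intro AE_I2) (simp only: norm_mult norm_of_real, intro mult_right_mono, auto)
  qed measurable
  from LIMSEQ_unique[OF this gaussian_plancherel_limit[OF h k]]
  have "of_real (1 / sqrt (2 * pi)) * (LINT u|lborel. ?P u)
      = of_real (sqrt (2 * pi)) * (LINT t|lborel. h t * cnj (k t))"
    by (simp only: integral_mult_right_zero)
  then have "of_real (sqrt (2 * pi)) * (of_real (1 / sqrt (2 * pi)) * (LINT u|lborel. ?P u))
      = of_real (sqrt (2 * pi)) * (of_real (sqrt (2 * pi)) * (LINT t|lborel. h t * cnj (k t)))"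
    by simp
  then show ?thesis
    unfolding mult.assoc[symmetric] of_real_mult[symmetric] by simp
qed

subsection \<open>Reduction to Borel representatives and to the Fourier transform\<close>

text \<open>\<open>P\<close> may fail to be measurable, so its exceptional set is first enlarged to
  a Borel null set, which can be translated.\<close>

lemma AE_lborel_shift:
  assumes "AE t in lborel. P (t :: real)"
  shows "AE t in lborel. P (t - w)"
proof -
  from assms obtain N where N: "{x \<in> space lborel. \<not> P x} \<subseteq> N" "N \<in> null_sets lborel"
    by (auto elim!: AE_E simp: null_sets_def)
  then have "AE t in lborel. t \<notin> N" by (simp add: AE_not_in)
  moreover have "Measurable.pred borel (\<lambda>t. t \<notin> N)" using N(2) by (auto simp: null_sets_def)
  ultimately have "AE t in lborel. - w + 1 * t \<notin> N"
    by (intro AE_borel_affine) auto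
  then show ?thesis by (rule eventually_mono) (use N(1) in auto)
qed

lemma L2_borel_representative:
  assumes f: "f \<in> L2"
  obtains f' where "sq_integrable f'" "AE t in lborel. f t = f' t"
proof -
  have "f \<in> borel_measurable lebesgue" using f by (simp add: L2_def)
  then have "(\<lambda>t. Re (f t)) \<in> borel_measurable lebesgue" "(\<lambda>t. Im (f t)) \<in> borel_measurable lebesgue"
    by measurable
  then obtain r i where [measurable]: "r \<in> borel_measurable lborel" "i \<in> borel_measurable lborel"
    and ae: "AE t in lborel. Re (f t) = r t" "AE t in lborel. Im (f t) = i t"
    using completion_ex_borel_measurable_real by blast
  define f' where "f' t = Complex (r t) (i t)" for t
  have [measurable]: "f' \<in> borel_measurable borel"
    using \<open>r \<in> _\<close> \<open>i \<in> _\<close> by (auto simp: f'_def borel_measurable_complex_iff)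
  have eq: "AE t in lborel. f t = f' t"
    using ae by eventually_elim (simp add: f'_def complex_eq_iff)
  have "integrable lebesgue (\<lambda>t. (cmod (f' t))\<^sup>2)"
  proof (rule integrable_cong_AE_imp)
    show "integrable lebesgue (\<lambda>t. (cmod (f t))\<^sup>2)" using f by (simp add: L2_def)
    show "AE t in lebesgue. (cmod (f t))\<^sup>2 = (cmod (f' t))\<^sup>2"
      using AE_completion[OF eq] by eventually_elim simp
  qed (intro measurable_completion, measurable)
  then have "sq_integrable f'"
    by (subst (asm) integrable_completion) (auto simp: sq_integrable_def)
  with eq show thesis by (rule that[rotated])
qed

lemma measurable_lebesgue_shift:
  fixes f :: "real \<Rightarrow> complex"
  assumes "f \<in> borel_measurable lebesgue"
  shows "(\<lambda>t. f (t - w)) \<in> borel_measurable lebesgue"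
proof -
  have "(\<lambda>x. - w + 1 * x :: real) \<in> lebesgue \<rightarrow>\<^sub>M lebesgue"
    using lebesgue_affine_measurable[where c = "\<lambda>x::real. 1" and t = "- w"] by simp
  from measurable_compose[OF this assms] show ?thesis by simp
qed

text \<open>Holds at every point \<open>(u, w)\<close>, not merely almost everywhere: for fixed
  \<open>w\<close> the translate of a null set in \<open>t\<close> is still null.\<close>

lemma wolct_cong_AE:
  assumes f: "AE t in lborel. f t = f' t" and \<phi>: "AE t in lborel. \<phi> t = \<phi>' t"
    and m: "f \<in> borel_measurable lebesgue" "f' \<in> borel_measurable lebesgue"
      "\<phi> \<in> borel_measurable lebesgue" "\<phi>' \<in> borel_measurable lebesgue"
  shows "wolct A \<phi> f u w = wolct A \<phi>' f' u w"
proof -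
  obtain a b c d u0 w0 where A: "A = (a, b, c, d, u0, w0)" by (cases A)
  note [measurable] = m measurable_lebesgue_shift[OF m(3)] measurable_lebesgue_shift[OF m(4)]
  have "(\<lambda>t. olct_kernel A t u) \<in> borel_measurable borel"
    unfolding A olct_kernel.simps by (intro borel_measurable_continuous_onI continuous_intros)
  then have [measurable]: "(\<lambda>t. olct_kernel A t u) \<in> borel_measurable lebesgue"
    by (intro measurable_completion) simp
  show ?thesis unfolding wolct_def
  proof (rule integral_cong_AE)
    show "AE t in lebesgue. f t * cnj (\<phi> (t - w)) * olct_kernel A t u = f' t * cnj (\<phi>' (t - w)) * olct_kernel A t u"
      using AE_completion[OF f] AE_completion[OF AE_lborel_shift[OF \<phi>, of w]] by eventually_elim simp
  qed measurable
qed

text \<open>Only the chirp and the term in \<open>t * (u - u0)\<close> of the exponent involve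
  \<open>t\<close>. What remains is a real phase in \<open>u\<close> times a constant, so
  \<open>C u\<close> has constant modulus.\<close>

lemma olct_kernel_factor:
  assumes "b \<noteq> 0"
  obtains C where "\<And>t u. olct_kernel (a, b, c, d, u0, w0) t u = C u * (cis (a / (2 * b) * t\<^sup>2) * cis (- ((u - u0) / b * t)))"
    "\<And>u. C u * cnj (C u) = of_real (1 / (2 * pi * \<bar>b\<bar>))"
proof
  let ?C = "\<lambda>u. 1 / csqrt (\<i> * 2 * of_real pi * of_real b) * cis (- (1 / b * u * (d * u0 - b * w0)) + d / (2 * b) * (u\<^sup>2 + u0\<^sup>2))"
  show "olct_kernel (a, b, c, d, u0, w0) t u = ?C u * (cis (a / (2 * b) * t\<^sup>2) * cis (- ((u - u0) / b * t)))" for t u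
    unfolding olct_kernel.simps cis_conv_exp mult.assoc exp_add[symmetric]
    by (intro arg_cong2[where f = "(*)"] refl arg_cong[where f = exp]) (simp add: algebra_simps diff_divide_distrib)
  show "?C u * cnj (?C u) = of_real (1 / (2 * pi * \<bar>b\<bar>))" for u
  proof -
    \<comment> \<open>Squaring undoes the root, so its branch and the sign of \<open>b\<close> do
      not affect the modulus.\<close>
    have "(cmod (csqrt (\<i> * 2 * of_real pi * of_real b)))\<^sup>2 = 2 * pi * \<bar>b\<bar>"
      unfolding norm_power[symmetric] power2_csqrt by (simp add: norm_mult)
    then have "(cmod (?C u))\<^sup>2 = 1 / (2 * pi * \<bar>b\<bar>)"
      by (simp add: norm_mult norm_divide power_divide)
    then show ?thesis by (metis complex_norm_square)
  qed
qed

subsection \<open>Integration over the window position\<close>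

text \<open>With \<open>t\<close> outermost, reflection and translation invariance make the inner
  integral over \<open>w\<close> independent of \<open>t\<close>, so it factors out. Fubini is
  therefore checked in the order \<open>(t, w)\<close> and then swapped.\<close>

lemma
  fixes p q :: "real \<Rightarrow> 'a :: {real_normed_field, banach, second_countable_topology}"
  assumes p: "integrable lborel p" and q: "integrable lborel q"
  shows integrable_mult_shift_pair:
      "integrable (lborel \<Otimes>\<^sub>M lborel) (\<lambda>(w, t). p t * q (t - w))"
    and integral_mult_shift_pair:
      "(LINT w|lborel. LINT t|lborel. p t * q (t - w)) = (LINT t|lborel. p t) * (LINT t|lborel. q t)"
proof -
  have [measurable]: "p \<in> borel_measurable borel" "q \<in> borel_measurable borel"
    using borel_measurable_integrable[OF p] borel_measurable_integrable[OF q] by simp_all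
  have reflect: "(LINT w|lborel. g (t - w)) = (LINT w|lborel. g w)"
    for g :: "real \<Rightarrow> 'b :: {banach, second_countable_topology}" and t
    using lborel_integral_real_affine[of "-1" g t] by simp
  have int: "integrable lborel (\<lambda>w. q (t - w))" for t
    using lborel_integrable_real_affine[OF q, of "-1" t] by simp
  have swapped: "integrable (lborel \<Otimes>\<^sub>M lborel) (\<lambda>(t, w). p t * q (t - w))"
  proof (rule lborel_pair.Fubini_integrable)
    show "integrable lborel (\<lambda>t. LINT w|lborel. norm (case (t, w) of (t, w) \<Rightarrow> p t * q (t - w)))"
      using p by (simp add: norm_mult reflect[of "\<lambda>x. norm (q x)"])
    show "AE t in lborel. integrable lborel (\<lambda>w. case (t, w) of (t, w) \<Rightarrow> p t * q (t - w))"
      using int by simp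
  qed measurable
  then show pair: "integrable (lborel \<Otimes>\<^sub>M lborel) (\<lambda>(w, t). p t * q (t - w))"
    using lborel_pair.integrable_product_swap by fastforce
  have "(LINT w|lborel. LINT t|lborel. p t * q (t - w)) = (LINT t|lborel. LINT w|lborel. p t * q (t - w))"
    by (rule lborel_pair.Fubini_integral[OF swapped])
  then show "(LINT w|lborel. LINT t|lborel. p t * q (t - w)) = (LINT t|lborel. p t) * (LINT t|lborel. q t)"
    by (simp add: reflect)
qed

text \<open>\<open>\<alpha> = a / (2 b)\<close> is the rate of the chirp in the kernel.\<close>

definition windowed :: "real \<Rightarrow> (real \<Rightarrow> complex) \<Rightarrow> (real \<Rightarrow> complex) \<Rightarrow> real \<Rightarrow> real \<Rightarrow> complex" where
  "windowed \<alpha> \<phi> f w t = f t * cnj (\<phi> (t - w)) * cis (\<alpha> * t\<^sup>2)"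

lemma integrable_windowed:
  assumes f: "sq_integrable f" and \<phi>: "sq_integrable \<phi>"
  shows "integrable lborel (windowed \<alpha> \<phi> f w)"
  unfolding windowed_def
  using sq_integrable_mult[OF f sq_integrable_cnj[OF sq_integrable_shift[OF \<phi>, of "- w"]]]
  by (intro integrable_mult_cis) auto

text \<open>The chirp has modulus 1, so the squared modulus is a product of an integrable function
  and a shifted one, integrable over the plane; both claims are its Fubini sections.\<close>

lemma
  assumes f: "sq_integrable f" and \<phi>: "sq_integrable \<phi>"
  shows AE_sq_integrable_windowed: "AE w in lborel. sq_integrable (windowed \<alpha> \<phi> f w)"
    and integrable_norm_windowed: "integrable lborel (\<lambda>w. LINT t|lborel. (cmod (windowed \<alpha> \<phi> f w t))\<^sup>2)"
proof -
  note [measurable] = sq_integrable_measurable[OF f] sq_integrable_measurable[OF \<phi>]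
  have "integrable (lborel \<Otimes>\<^sub>M lborel) (\<lambda>(w, t). (cmod (f t))\<^sup>2 * (cmod (\<phi> (t - w)))\<^sup>2)"
    by (intro integrable_mult_shift_pair sq_integrable_norm f \<phi>)
  then have int: "integrable (lborel \<Otimes>\<^sub>M lborel) (\<lambda>(w, t). (cmod (windowed \<alpha> \<phi> f w t))\<^sup>2)"
    by (simp add: windowed_def norm_mult power_mult_distrib)
  show "integrable lborel (\<lambda>w. LINT t|lborel. (cmod (windowed \<alpha> \<phi> f w t))\<^sup>2)"
    by (rule lborel_pair.integrable_fst[OF int])
  have [measurable]: "windowed \<alpha> \<phi> f w \<in> borel_measurable borel" for w
    unfolding windowed_def by measurable
  show "AE w in lborel. sq_integrable (windowed \<alpha> \<phi> f w)"
    using lborel_pair.AE_integrable_fst[OF int] by eventually_elim (simp add: sq_integrable_def)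
qed

lemma measurable_fourier_windowed:
  assumes f: "sq_integrable f" and \<phi>: "sq_integrable \<phi>" and b: "b \<noteq> 0"
  shows "(\<lambda>(w, u). fourier (windowed \<alpha> \<phi> f w) ((u - u0) / b)) \<in> borel_measurable (lborel \<Otimes>\<^sub>M lborel)"
proof -
  note [measurable] = sq_integrable_measurable[OF f] sq_integrable_measurable[OF \<phi>]
  show ?thesis unfolding fourier_def windowed_def by measurable
qed

text \<open>Plancherel applies for almost every \<open>w\<close>, where both windowed signals are
  square integrable. The factor \<open>\<bar>b\<bar>\<close> is the Jacobian of
  \<open>u = u0 + b * x\<close>.\<close>

lemma windowed_fourier_orthogonality:
  fixes \<alpha> b u0 :: real
  assumes f: "sq_integrable f" and g: "sq_integrable g" and \<phi>: "sq_integrable \<phi>" and \<psi>: "sq_integrable \<psi>"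
    and b: "b \<noteq> 0"
  defines "P \<equiv> \<lambda>w u. fourier (windowed \<alpha> \<phi> f w) ((u - u0) / b) * cnj (fourier (windowed \<alpha> \<psi> g w) ((u - u0) / b))"
  shows "integrable (lborel \<Otimes>\<^sub>M lborel) (\<lambda>(w, u). P w u)"
    and "(LINT w|lborel. LINT u|lborel. P w u)
      = of_real (2 * pi * \<bar>b\<bar>) * (LINT t|lborel. f t * cnj (g t)) * (LINT t|lborel. \<psi> t * cnj (\<phi> t))"
proof -
  note [measurable] = sq_integrable_measurable[OF f] sq_integrable_measurable[OF \<phi>]
    sq_integrable_measurable[OF g] sq_integrable_measurable[OF \<psi>]
  let ?h = "windowed \<alpha> \<phi> f" and ?k = "windowed \<alpha> \<psi> g"
  define Q where "Q w x = fourier (?h w) x * cnj (fourier (?k w) x)" for w x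
  have PQ: "P w u = Q w ((u - u0) / b)" for w u by (simp add: P_def Q_def)
  have Pmeas[measurable]: "(\<lambda>(w, u). P w u) \<in> borel_measurable (lborel \<Otimes>\<^sub>M lborel)"
  proof -
    note [measurable] = measurable_fourier_windowed[OF f \<phi> b, of \<alpha> u0] measurable_fourier_windowed[OF g \<psi> b, of \<alpha> u0]
    show ?thesis unfolding P_def by measurable
  qed
  have rescale: "(LINT u|lborel. G ((u - u0) / b)) = \<bar>b\<bar> *\<^sub>R (LINT x|lborel. G x)"
    for G :: "real \<Rightarrow> 'b :: {banach, second_countable_topology}"
    using b lborel_integral_real_affine[of b "\<lambda>u. G ((u - u0) / b)" u0] by simp
  have sq: "AE w in lborel. sq_integrable (?h w) \<and> sq_integrable (?k w)"
    using AE_sq_integrable_windowed[OF f \<phi>, of \<alpha>] AE_sq_integrable_windowed[OF g \<psi>, of \<alpha>]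
    by eventually_elim simp
  show "integrable (lborel \<Otimes>\<^sub>M lborel) (\<lambda>(w, u). P w u)"
  proof (rule lborel_pair.Fubini_integrable[OF Pmeas])
    let ?N = "\<lambda>h. LINT t|lborel. (cmod (h t))\<^sup>2"
    have "integrable lborel (\<lambda>w. LINT u|lborel. cmod (P w u))"
    proof (rule Bochner_Integration.integrable_bound)
      \<comment> \<open>Each \<open>pi\<close> is the Plancherel factor \<open>2 * pi\<close> halved
        by \<open>norm_correlation_le\<close>, used below at shift 0.\<close>
      show "integrable lborel (\<lambda>w. \<bar>b\<bar> * (pi * ?N (?h w) + pi * ?N (?k w)))"
        by (intro integrable_mult_right Bochner_Integration.integrable_add integrable_norm_windowed f g \<phi> \<psi>)
      show "AE w in lborel. norm (LINT u|lborel. cmod (P w u)) \<le> norm (\<bar>b\<bar> * (pi * ?N (?h w) + pi * ?N (?k w)))"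
        using sq
      proof eventually_elim
        case (elim w)
        have N: "?N (fourier h) = 2 * pi * ?N h" if "sq_integrable h" "integrable lborel h" for h
        proof -
          have "complex_of_real (?N (fourier h)) = of_real (2 * pi * ?N h)"
            using plancherel[OF that that]
            by (simp only: complex_norm_square[symmetric] of_real_mult of_real_power[symmetric] integral_complex_of_real)
          then show ?thesis by (simp only: of_real_eq_iff)
        qed
        have "(LINT u|lborel. cmod (P w u)) = \<bar>b\<bar> * (LINT x|lborel. cmod (Q w x))"
          unfolding PQ using rescale[of "\<lambda>x. cmod (Q w x)"] by simp
        also have "(LINT x|lborel. cmod (Q w x)) \<le> ?N (fourier (?h w)) / 2 + ?N (\<lambda>x. cnj (fourier (?k w) x)) / 2"
          unfolding Q_def
          using norm_correlation_le[of "fourier (?h w)" "\<lambda>x. cnj (fourier (?k w) x)" 0] elim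
          by (simp add: sq_integrable_fourier sq_integrable_cnj integrable_windowed f g \<phi> \<psi>)
        also have "\<dots> = pi * ?N (?h w) + pi * ?N (?k w)"
          using elim by (simp add: N integrable_windowed f g \<phi> \<psi>)
        finally have "(LINT u|lborel. cmod (P w u)) \<le> \<bar>b\<bar> * (pi * ?N (?h w) + pi * ?N (?k w))"
          by (simp add: mult_left_mono)
        then show ?case by (simp add: abs_mult)
      qed
    qed measurable
    then show "integrable lborel (\<lambda>w. LINT u|lborel. cmod (case (w, u) of (w, u) \<Rightarrow> P w u))" by simp
    show "AE w in lborel. integrable lborel (\<lambda>u. case (w, u) of (w, u) \<Rightarrow> P w u)"
      using sq
    proof eventually_elim
      case (elim w)
      have "integrable lborel (Q w)" unfolding Q_def using elim
        by (intro sq_integrable_mult sq_integrable_cnj sq_integrable_fourier integrable_windowed f g \<phi> \<psi>) auto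
      from lborel_integrable_real_affine[OF this, of "1 / b" "- u0 / b"] b
      show ?case by (simp add: PQ diff_divide_distrib)
    qed
  qed
  have "(LINT w|lborel. LINT u|lborel. P w u)
     = (LINT w|lborel. of_real (2 * pi * \<bar>b\<bar>) * (LINT t|lborel. (f t * cnj (g t)) * (\<psi> (t - w) * cnj (\<phi> (t - w)))))"
  proof (rule integral_cong_AE)
    show "AE w in lborel. (LINT u|lborel. P w u) = of_real (2 * pi * \<bar>b\<bar>) * (LINT t|lborel. (f t * cnj (g t)) * (\<psi> (t - w) * cnj (\<phi> (t - w))))"
      using sq
    proof eventually_elim
      case (elim w)
      have "(LINT u|lborel. P w u) = \<bar>b\<bar> *\<^sub>R (LINT x|lborel. Q w x)"
        unfolding PQ by (rule rescale)
      also have "(LINT x|lborel. Q w x) = of_real (2 * pi) * (LINT t|lborel. ?h w t * cnj (?k w t))"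
        unfolding Q_def using elim by (intro plancherel integrable_windowed f g \<phi> \<psi>) auto
      also have "(\<lambda>t. ?h w t * cnj (?k w t)) = (\<lambda>t. (f t * cnj (g t)) * (\<psi> (t - w) * cnj (\<phi> (t - w))))"
      proof
        fix t
        have "cis (\<alpha> * t\<^sup>2) * cis (- (\<alpha> * t\<^sup>2)) = 1" by (simp add: cis_mult)
        then show "?h w t * cnj (?k w t) = (f t * cnj (g t)) * (\<psi> (t - w) * cnj (\<phi> (t - w)))"
          unfolding windowed_def by (simp add: cis_cnj mult_ac)
      qed
      finally show ?case by (simp add: scaleR_conv_of_real)
    qed
  qed measurable
  \<comment> \<open>The integrand is a function of \<open>t\<close>, namely
    \<open>f t * cnj (g t)\<close>, times a function of \<open>t - w\<close>, so the window integral
    separates.\<close>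
  also have "\<dots> = of_real (2 * pi * \<bar>b\<bar>) * ((LINT t|lborel. f t * cnj (g t)) * (LINT t|lborel. \<psi> t * cnj (\<phi> t)))"
    by (subst integral_mult_right_zero, subst integral_mult_shift_pair)
      (intro refl sq_integrable_mult sq_integrable_cnj f g \<phi> \<psi>)+
  finally show "(LINT w|lborel. LINT u|lborel. P w u)
      = of_real (2 * pi * \<bar>b\<bar>) * (LINT t|lborel. f t * cnj (g t)) * (LINT t|lborel. \<psi> t * cnj (\<phi> t))"
    by (simp add: mult.assoc)
qed

section \<open>Transfer back to the offset transform\<close>

lemma wolct_eq_fourier:
  assumes f: "sq_integrable f" and \<phi>: "sq_integrable \<phi>"
    and K: "\<And>t u. olct_kernel A t u = C u * (cis (\<alpha> * t\<^sup>2) * cis (- ((u - u0) / b * t)))"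
  shows "wolct A \<phi> f u w = C u * fourier (windowed \<alpha> \<phi> f w) ((u - u0) / b)"
proof -
  note [measurable] = sq_integrable_measurable[OF f] sq_integrable_measurable[OF \<phi>]
  have "wolct A \<phi> f u w = (LINT t|lebesgue. C u * (windowed \<alpha> \<phi> f w t * cis (- ((u - u0) / b * t))))"
    unfolding wolct_def K windowed_def by (simp add: mult_ac)
  also have "\<dots> = (LINT t|lborel. C u * (windowed \<alpha> \<phi> f w t * cis (- ((u - u0) / b * t))))"
    unfolding windowed_def by (rule integral_completion) measurable
  also have "\<dots> = C u * fourier (windowed \<alpha> \<phi> f w) ((u - u0) / b)"
    unfolding fourier_def by (rule integral_mult_right_zero)
  finally show ?thesis .
qed

lemma L2_inner_cong_AE:
  assumes f: "AE t in lborel. f t = f' t" and g: "AE t in lborel. g t = g' t"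
    and m: "f \<in> borel_measurable lebesgue" "g \<in> borel_measurable lebesgue"
    and m': "sq_integrable f'" "sq_integrable g'"
  shows "L2_inner f g = (LINT t|lborel. f' t * cnj (g' t))"
proof -
  note [measurable] = m sq_integrable_measurable[OF m'(1)] sq_integrable_measurable[OF m'(2)]
  have meas: "(\<lambda>t. f' t * cnj (g' t)) \<in> borel_measurable lborel" by measurable
  have "L2_inner f g = (LINT t|lebesgue. f' t * cnj (g' t))" unfolding L2_inner_def
  proof (rule integral_cong_AE)
    show "(\<lambda>t. f' t * cnj (g' t)) \<in> borel_measurable lebesgue" by (rule measurable_completion[OF meas])
    show "AE t in lebesgue. f t * cnj (g t) = f' t * cnj (g' t)"
      using AE_completion[OF f] AE_completion[OF g] by eventually_elim simp
  qed measurable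
  then show ?thesis using integral_completion[OF meas] by simp
qed

theorem mainTheorem4:
  fixes a b c d u0 w0 :: real
    and \<phi> \<psi> f g :: "real \<Rightarrow> complex"
    and A :: olct_param
  assumes "A = (a, b, c, d, u0, w0)"
    and "a * d - b * c = 1" and "b \<noteq> 0"
    and "\<phi> \<in> L2_nonzero" and "\<psi> \<in> L2_nonzero"
    and "f \<in> L2" and "g \<in> L2"
  shows "integrable (lebesgue :: (real \<times> real) measure)
           (\<lambda>(u, w). wolct A \<phi> f u w * cnj (wolct A \<psi> g u w)) \<and>
         (LINT w|lebesgue. LINT u|lebesgue. wolct A \<phi> f u w * cnj (wolct A \<psi> g u w)) =
           L2_inner f g * L2_inner \<psi> \<phi>"
proof -
  have L2: "\<phi> \<in> L2" "\<psi> \<in> L2" using assms by (auto simp: L2_nonzero_def)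
  have leb: "h \<in> borel_measurable lebesgue" if "h \<in> L2" for h using that by (simp add: L2_def)
  have leb': "h \<in> borel_measurable lebesgue" if "sq_integrable h" for h
    using sq_integrable_measurable[OF that] by (intro measurable_completion) simp
  obtain f' where f': "sq_integrable f'" "AE t in lborel. f t = f' t"
    using L2_borel_representative[OF \<open>f \<in> L2\<close>] .
  obtain g' where g': "sq_integrable g'" "AE t in lborel. g t = g' t"
    using L2_borel_representative[OF \<open>g \<in> L2\<close>] .
  obtain \<phi>' where \<phi>': "sq_integrable \<phi>'" "AE t in lborel. \<phi> t = \<phi>' t"
    using L2_borel_representative[OF L2(1)] .
  obtain \<psi>' where \<psi>': "sq_integrable \<psi>'" "AE t in lborel. \<psi> t = \<psi>' t"
    using L2_borel_representative[OF L2(2)] .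
  obtain C where C: "\<And>t u. olct_kernel A t u = C u * (cis (a / (2 * b) * t\<^sup>2) * cis (- ((u - u0) / b * t)))"
    "\<And>u. C u * cnj (C u) = of_real (1 / (2 * pi * \<bar>b\<bar>))"
    using olct_kernel_factor[OF \<open>b \<noteq> 0\<close>] unfolding assms(1) by blast
  define P where "P w u = fourier (windowed (a / (2 * b)) \<phi>' f' w) ((u - u0) / b)
      * cnj (fourier (windowed (a / (2 * b)) \<psi>' g' w) ((u - u0) / b))" for w u
  let ?c = "complex_of_real (1 / (2 * pi * \<bar>b\<bar>))"
  have P: "integrable (lborel \<Otimes>\<^sub>M lborel) (\<lambda>(w, u). P w u)"
    "(LINT w|lborel. LINT u|lborel. P w u)
      = of_real (2 * pi * \<bar>b\<bar>) * (LINT t|lborel. f' t * cnj (g' t)) * (LINT t|lborel. \<psi>' t * cnj (\<phi>' t))"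
    unfolding P_def by (intro windowed_fourier_orthogonality f' g' \<phi>' \<psi>' \<open>b \<noteq> 0\<close>)+
  have [measurable]: "case_prod P \<in> borel_measurable (lborel \<Otimes>\<^sub>M lborel)"
    using P(1) by (rule borel_measurable_integrable)
  \<comment> \<open>The factor \<open>C u\<close> enters once plain and once conjugated, leaving a
    constant independent of \<open>u\<close>.\<close>
  have V: "wolct A \<phi> f u w * cnj (wolct A \<psi> g u w) = ?c * P w u" for u w
  proof -
    have "wolct A \<phi> f u w = C u * fourier (windowed (a / (2 * b)) \<phi>' f' w) ((u - u0) / b)"
      unfolding wolct_cong_AE[OF f'(2) \<phi>'(2) leb[OF assms(6)] leb'[OF f'(1)] leb[OF L2(1)] leb'[OF \<phi>'(1)]]
        by (rule wolct_eq_fourier[OF f'(1) \<phi>'(1) C(1)])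
    moreover have "wolct A \<psi> g u w = C u * fourier (windowed (a / (2 * b)) \<psi>' g' w) ((u - u0) / b)"
      unfolding wolct_cong_AE[OF g'(2) \<psi>'(2) leb[OF assms(7)] leb'[OF g'(1)] leb[OF L2(2)] leb'[OF \<psi>'(1)]]
        by (rule wolct_eq_fourier[OF g'(1) \<psi>'(1) C(1)])
    ultimately have "wolct A \<phi> f u w * cnj (wolct A \<psi> g u w) = (C u * cnj (C u)) * P w u"
      by (simp add: P_def mult_ac)
    then show ?thesis unfolding C(2) .
  qed
  \<comment> \<open>The plane in the claim has coordinates \<open>(u, w)\<close>, whereas
    \<open>P\<close> was treated in the order \<open>(w, u)\<close>.\<close>
  have swapped: "integrable (lborel \<Otimes>\<^sub>M lborel) (\<lambda>(u, w). ?c * P w u)"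
    using integrable_mult_right[OF lborel_pair.integrable_product_swap[OF P(1)], of ?c]
    by (simp add: case_prod_unfold)
  then have int: "integrable lebesgue (\<lambda>(u, w). wolct A \<phi> f u w * cnj (wolct A \<psi> g u w))"
    unfolding V lborel_prod by (subst integrable_completion) auto
  \<comment> \<open>\<open>P\<close> is built from Borel representatives, so Lebesgue integrals
    agree with integrals over \<open>lborel\<close>, first in \<open>u\<close> and then in
    \<open>w\<close>.\<close>
  have inner: "(LINT u|lebesgue. ?c * P w u) = ?c * (LINT u|lborel. P w u)" for w
    by (subst integral_completion) simp_all
  have "(LINT w|lebesgue. LINT u|lebesgue. wolct A \<phi> f u w * cnj (wolct A \<psi> g u w))
      = ?c * (LINT w|lborel. LINT u|lborel. P w u)"
    unfolding V inner by (subst integral_completion) simp_all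
  also have "\<dots> = (LINT t|lborel. f' t * cnj (g' t)) * (LINT t|lborel. \<psi>' t * cnj (\<phi>' t))"
    unfolding P(2) using \<open>b \<noteq> 0\<close> by (simp add: field_simps)
  also have "\<dots> = L2_inner f g * L2_inner \<psi> \<phi>"
    using L2_inner_cong_AE[OF f'(2) g'(2)] L2_inner_cong_AE[OF \<psi>'(2) \<phi>'(2)] f' g' \<phi>' \<psi>' assms L2 leb by simp
  finally show ?thesis using int by blast
qed

end
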